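(* Let $l\ge 2$ and let $a,b\in\{1,\dots,l-1\}$ be such that $X=X(\mathbb{Z}_{2l},\{\pm a,\pm b\})$ is a connected $4$-regular circulant graph. Let $x,y\in\mathbb{Z}_{2l}$. Then $X$ admits perfect state transfer from $d^*e_x$ to $d^*e_y$ with minimum such time $\tau\in\mathbb{Z}_{\ge1}$ if and only if $a+b=l$, $y=x+l$, and one of the following holds: (i) $l$ is odd and $\tau=2l$; (ii) $l\equiv 2\pmod 4$ and $\tau=l$.
   Context: All graphs are finite and simple. For a graph $\Gamma=(V,E)$, the set of symmetric arcs is $\mathcal{A}=\{(x,y),(y,x)\mid \{x,y\}\in E\}$; for an arc $a=(x,y)$ write $t(a)=y$, $a^{-1}=(y,x)$. The boundary matrix $d\in\mathbb{C}^{V\times\mathcal{A}}$ is $d_{x,a}=\frac{1}{\sqrt{\deg x}}\delta_{x,t(a)}$; the shift matrix $R$ is $R_{a,b}=\delta_{a,b^{-1}}$; the time evolution matrix is $U=R(2d^*d-I_{\mathcal{A}})$. For $x\in V$, $e_x$ is the standard unit vector of $\mathbb{C}^V$ and $d^*e_x$ is a vertex type state. Perfect state transfer from a state $\Phi$ to a distinct state $\Psi$ at time $\tau\in\mathbb{Z}_{\ge1}$ means $U^\tau\Phi=\gamma\Psi$ for some $\gamma\in\mathbb{C}$ with $|\gamma|=1$. For $S\subseteq\mathbb{Z}_n\setminus\{0\}$ with $S=-S$, the circulant graph $X(\mathbb{Z}_n,S)$ has vertex set $\mathbb{Z}_n$ and edge set $\{\{x,y\}\mid y-x\in S\}$. 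*)

theory Defs
  imports Complex_Main
begin

text \<open>A finite simple graph is given by a vertex set V and a symmetric irreflexive
adjacency predicate E. Vectors in C^A (A the set of symmetric arcs) are functions
on arcs; only their values on A matter. Matrices are functions of two indices.\<close>

definition arcs :: "'v set \<Rightarrow> ('v \<Rightarrow> 'v \<Rightarrow> bool) \<Rightarrow> ('v \<times> 'v) set" where
  "arcs V E = {(x, y). x \<in> V \<and> y \<in> V \<and> E x y}"

definition gdeg :: "'v set \<Rightarrow> ('v \<Rightarrow> 'v \<Rightarrow> bool) \<Rightarrow> 'v \<Rightarrow> nat" where
  "gdeg V E x = card {y \<in> V. E x y}"

definition graph_connected :: "'v set \<Rightarrow> ('v \<Rightarrow> 'v \<Rightarrow> bool) \<Rightarrow> bool" where
  "graph_connected V E \<longleftrightarrow>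
     (\<forall>x\<in>V. \<forall>y\<in>V. (x, y) \<in> {(u, v). u \<in> V \<and> v \<in> V \<and> E u v}\<^sup>*)"

definition regular :: "'v set \<Rightarrow> ('v \<Rightarrow> 'v \<Rightarrow> bool) \<Rightarrow> nat \<Rightarrow> bool" where
  "regular V E k \<longleftrightarrow> (\<forall>x\<in>V. gdeg V E x = k)"

text \<open>Boundary matrix d_{x,a} = deg(x)^{-1/2} [x = t(a)], with t(a) = snd a.\<close>
definition bdry :: "'v set \<Rightarrow> ('v \<Rightarrow> 'v \<Rightarrow> bool) \<Rightarrow> 'v \<Rightarrow> 'v \<times> 'v \<Rightarrow> complex" where
  "bdry V E x a = (if x = snd a then complex_of_real (1 / sqrt (real (gdeg V E x))) else 0)"

text \<open>Shift matrix R_{a,b} = [a = b^{-1}].\<close>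
definition shift :: "'v \<times> 'v \<Rightarrow> 'v \<times> 'v \<Rightarrow> complex" where
  "shift a b = (if a = prod.swap b then 1 else 0)"

text \<open>(d^* d)_{a,b} = sum over vertices x of conj(d_{x,a}) d_{x,b}.\<close>
definition dstar_d :: "'v set \<Rightarrow> ('v \<Rightarrow> 'v \<Rightarrow> bool) \<Rightarrow> 'v \<times> 'v \<Rightarrow> 'v \<times> 'v \<Rightarrow> complex" where
  "dstar_d V E a b = (\<Sum>x\<in>V. cnj (bdry V E x a) * bdry V E x b)"

text \<open>Time evolution matrix U = R (2 d^* d - I).\<close>
definition evol :: "'v set \<Rightarrow> ('v \<Rightarrow> 'v \<Rightarrow> bool) \<Rightarrow> 'v \<times> 'v \<Rightarrow> 'v \<times> 'v \<Rightarrow> complex" where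
  "evol V E a b = (\<Sum>c\<in>arcs V E. shift a c *
      (2 * dstar_d V E c b - (if c = b then 1 else 0)))"

text \<open>Matrix-vector product over the arc set, and U^t applied to a state.\<close>
definition mat_vec :: "('i set) \<Rightarrow> ('i \<Rightarrow> 'i \<Rightarrow> complex) \<Rightarrow> ('i \<Rightarrow> complex) \<Rightarrow> 'i \<Rightarrow> complex" where
  "mat_vec I M v = (\<lambda>i. \<Sum>j\<in>I. M i j * v j)"

definition evolve :: "'v set \<Rightarrow> ('v \<Rightarrow> 'v \<Rightarrow> bool) \<Rightarrow> nat \<Rightarrow> ('v \<times> 'v \<Rightarrow> complex) \<Rightarrow> ('v \<times> 'v \<Rightarrow> complex)" where
  "evolve V E t \<Phi> = (mat_vec (arcs V E) (evol V E) ^^ t) \<Phi>"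

text \<open>Vertex type state d^* e_x : its a-entry is conj(d_{x,a}).\<close>
definition vstate :: "'v set \<Rightarrow> ('v \<Rightarrow> 'v \<Rightarrow> bool) \<Rightarrow> 'v \<Rightarrow> 'v \<times> 'v \<Rightarrow> complex" where
  "vstate V E x = (\<lambda>a. cnj (bdry V E x a))"

text \<open>Perfect state transfer from \<Phi> to a distinct \<Psi> at time \<tau> \<ge> 1
  (vectors compared as elements of C^A).\<close>
definition PST :: "'v set \<Rightarrow> ('v \<Rightarrow> 'v \<Rightarrow> bool) \<Rightarrow> ('v \<times> 'v \<Rightarrow> complex) \<Rightarrow> ('v \<times> 'v \<Rightarrow> complex) \<Rightarrow> nat \<Rightarrow> bool" where
  "PST V E \<Phi> \<Psi> \<tau> \<longleftrightarrow>
     (\<exists>a\<in>arcs V E. \<Phi> a \<noteq> \<Psi> a) \<and> \<tau> \<ge> 1 \<and>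
     (\<exists>\<gamma>::complex. cmod \<gamma> = 1 \<and> (\<forall>a\<in>arcs V E. evolve V E \<tau> \<Phi> a = \<gamma> * \<Psi> a))"

definition min_PST_time :: "'v set \<Rightarrow> ('v \<Rightarrow> 'v \<Rightarrow> bool) \<Rightarrow> ('v \<times> 'v \<Rightarrow> complex) \<Rightarrow> ('v \<times> 'v \<Rightarrow> complex) \<Rightarrow> nat \<Rightarrow> bool" where
  "min_PST_time V E \<Phi> \<Psi> \<tau> \<longleftrightarrow> PST V E \<Phi> \<Psi> \<tau> \<and> (\<forall>\<sigma>. 1 \<le> \<sigma> \<and> \<sigma> < \<tau> \<longrightarrow> \<not> PST V E \<Phi> \<Psi> \<sigma>)"

text \<open>Circulant graph X(Z_n, S): vertices {0..<n} (representatives of Z_n),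
  x ~ y iff (y - x) mod n \<in> S, with S a set of residues in {0..<n}.\<close>
definition circ_V :: "int \<Rightarrow> int set" where
  "circ_V n = {0..<n}"

definition circ_E :: "int \<Rightarrow> int set \<Rightarrow> int \<Rightarrow> int \<Rightarrow> bool" where
  "circ_E n S x y \<longleftrightarrow> (y - x) mod n \<in> S"

end

theory Submission
  imports Defs "Jordan_Normal_Form.Char_Poly"
begin

text \<open>Summing the amplitudes of a state over the arcs that end in a vertex turns the walk \<open>U\<close> on a
  \<open>k\<close>-regular graph into the Chebyshev recurrence of \<open>A/k\<close>. Hence perfect state transfer from \<open>x\<close> to
  \<open>y\<close> at time \<open>\<tau>\<close> means that \<open>cos (\<tau> \<theta>\<^sub>j) \<chi>\<^sub>j(x) = \<gamma> \<chi>\<^sub>j(y)\<close> for all characters \<open>\<chi>\<^sub>j\<close> of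
  \<open>\<int>/2l\<close>, where \<open>cos \<theta>\<^sub>j\<close> is the eigenvalue of \<open>\<chi>\<^sub>j\<close>. The trivial character gives \<open>\<gamma> = 1\<close>, and
  \<open>\<chi>\<^sub>1\<close> gives \<open>y = x + l\<close> and \<open>cos (\<tau> \<theta>\<^sub>1) = -1\<close>. So \<open>2 cos \<theta>\<^sub>1\<close> is a sum of two roots of unity, in
  particular an algebraic integer. Up to a unit it equals \<open>(1 + \<zeta>\<^bsup>a+b\<^esup>) (1 + \<zeta>\<^bsup>a-b\<^esup>) / 2\<close>
  with \<open>\<zeta> = exp (\<pi> i / l)\<close>, whose 2-adic valuation is negative unless it vanishes, i.e. unless
  \<open>a + b = l\<close>. In that case the eigenvalues at odd \<open>j\<close> are 0 and those at even \<open>j\<close> are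
  \<open>cos (\<pi> j a / l)\<close>, so the condition becomes \<open>\<tau> \<equiv> 2 (mod 4)\<close> and \<open>l\<close> divides \<open>\<tau>\<close>.\<close>

subsection \<open>Roots of unity and divisibility by 2\<close>

text \<open>This is the ring Z[w], given as values of integer polynomials at \<open>w\<close>.
  Divisibility statements about roots of unity are phrased inside it by explicit cofactors, which
  replaces 2-adic valuations.\<close>

definition int_adjoin :: "complex \<Rightarrow> complex set" where
  "int_adjoin w = range (\<lambda>p. poly (map_poly of_int p) w)"

lemma int_adjoin_of_int [intro]: "of_int m \<in> int_adjoin w"
proof -
  have "of_int m = poly (map_poly of_int [:m:]) w" by (simp add: of_int_hom.map_poly_pCons_hom)
  then show ?thesis unfolding int_adjoin_def by blast
qed

lemma int_adjoin_generator: "w \<in> int_adjoin w"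
proof -
  have "w = poly (map_poly of_int [:0, 1:]) w" by simp
  then show ?thesis unfolding int_adjoin_def by blast
qed

lemma int_adjoin_add:
  assumes "u \<in> int_adjoin w" "v \<in> int_adjoin w"
  shows "u + v \<in> int_adjoin w"
proof -
  obtain p q where "u = poly (map_poly of_int p) w" "v = poly (map_poly of_int q) w"
    using assms unfolding int_adjoin_def by blast
  then have "u + v = poly (map_poly of_int (p + q)) w"
    by (simp add: of_int_poly_hom.hom_add)
  then show ?thesis unfolding int_adjoin_def by blast
qed

lemma int_adjoin_mult:
  assumes "u \<in> int_adjoin w" "v \<in> int_adjoin w"
  shows "u * v \<in> int_adjoin w"
proof -
  obtain p q where "u = poly (map_poly of_int p) w" "v = poly (map_poly of_int q) w"
    using assms unfolding int_adjoin_def by blast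
  then have "u * v = poly (map_poly of_int (p * q)) w"
    by (simp add: of_int_poly_hom.hom_mult)
  then show ?thesis unfolding int_adjoin_def by blast
qed

lemma int_adjoin_0 [simp]: "0 \<in> int_adjoin w"
  and int_adjoin_1 [simp]: "1 \<in> int_adjoin w"
  and int_adjoin_numeral [simp]: "numeral n \<in> int_adjoin w"
  using int_adjoin_of_int[of 0] int_adjoin_of_int[of 1] int_adjoin_of_int[of "numeral n"]
  by simp_all

lemma int_adjoin_uminus: "u \<in> int_adjoin w \<Longrightarrow> - u \<in> int_adjoin w"
  using int_adjoin_mult[OF int_adjoin_of_int[of "-1"]] by simp

lemma int_adjoin_diff: "u \<in> int_adjoin w \<Longrightarrow> v \<in> int_adjoin w \<Longrightarrow> u - v \<in> int_adjoin w"
  using int_adjoin_add[OF _ int_adjoin_uminus] by fastforce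

lemma int_adjoin_power: "u \<in> int_adjoin w \<Longrightarrow> u ^ n \<in> int_adjoin w"
  by (induction n) (auto intro: int_adjoin_mult)

lemma int_adjoin_sum: "(\<And>i. i \<in> I \<Longrightarrow> f i \<in> int_adjoin w) \<Longrightarrow> sum f I \<in> int_adjoin w"
  by (induction I rule: infinite_finite_induct) (auto intro: int_adjoin_add)

lemmas int_adjoin_intros =
  int_adjoin_0 int_adjoin_1 int_adjoin_numeral int_adjoin_of_int int_adjoin_add int_adjoin_mult
  int_adjoin_uminus int_adjoin_diff int_adjoin_power int_adjoin_sum

text \<open>Multiplication by an element of the ring acts on the powers of \<open>w\<close> by an integer matrix,
  so the element is a root of a monic integer characteristic polynomial.\<close>

lemma algebraic_int_int_adjoin:
  assumes w: "w ^ N = 1" "N > 0" and z: "z \<in> int_adjoin w"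
  shows "algebraic_int z"
proof -
  obtain p where p: "z = poly (map_poly of_int p) w"
    using z unfolding int_adjoin_def by blast
  define M :: "int mat" where
    \<comment> \<open>Row \<open>i\<close> records the expansion of \<open>z * w ^ i\<close> with
      exponents reduced modulo \<open>N\<close>. The powers of \<open>w\<close> may be linearly
      dependent; an eigenvector only has to be nonzero, and entry 0 of \<open>v\<close> is
      1.\<close>
    "M = mat N N (\<lambda>(i, k). \<Sum>j\<le>degree p. if (i + j) mod N = k then coeff p j else 0)"
  define M' :: "complex mat" where "M' = map_mat of_int M"
  define v where "v = vec N (\<lambda>i. w ^ i)"
  have carr: "M \<in> carrier_mat N N" "M' \<in> carrier_mat N N" unfolding M_def M'_def by auto
  have wmod: "w ^ (n mod N) = w ^ n" for n
  proof -
    have "w ^ n = w ^ (n mod N + N * (n div N))" by simp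
    also have "\<dots> = w ^ (n mod N)" unfolding power_add power_mult w by simp
    finally show ?thesis by simp
  qed
  have "M' *\<^sub>v v = z \<cdot>\<^sub>v v"
  proof (rule eq_vecI)
    fix i assume "i < dim_vec (z \<cdot>\<^sub>v v)"
    then have i: "i < N" by (simp add: v_def)
    have "(M' *\<^sub>v v) $ i =
        (\<Sum>k<N. \<Sum>j\<le>degree p. if (i + j) mod N = k then of_int (coeff p j) * w ^ k else 0)"
      using i unfolding M'_def M_def v_def
      by (auto simp: scalar_prod_def sum_distrib_right lessThan_atLeast0 intro!: sum.cong)
    also have "\<dots> = (\<Sum>j\<le>degree p. \<Sum>k<N.
        if (i + j) mod N = k then of_int (coeff p j) * w ^ k else 0)"
      by (rule sum.swap)
    also have "\<dots> = (\<Sum>j\<le>degree p. of_int (coeff p j) * w ^ (i + j))"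
      using w by (simp add: wmod)
    also have "\<dots> = z * w ^ i"
      by (simp add: p poly_altdef power_add sum_distrib_left sum_distrib_right mult_ac)
    finally show "(M' *\<^sub>v v) $ i = (z \<cdot>\<^sub>v v) $ i" using i by (simp add: v_def)
  qed (use carr in \<open>auto simp: v_def\<close>)
  moreover have "v \<noteq> 0\<^sub>v N"
    using w(2) by (auto simp: v_def vec_eq_iff)
  ultimately have "eigenvalue M' z"
    using carr unfolding eigenvalue_def eigenvector_def by (intro exI[of _ v]) (auto simp: v_def)
  then have "poly (char_poly M') z = 0"
    using eigenvalue_root_char_poly carr by blast
  moreover have "char_poly M' = map_poly of_int (char_poly M)"
    unfolding M'_def by (rule of_int_hom.char_poly_hom[OF carr(1)])
  moreover have "lead_coeff (char_poly M) = 1"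
    using degree_monic_char_poly[OF carr(1)] by simp
  ultimately show ?thesis
    unfolding algebraic_int_altdef_ipoly by metis
qed

text \<open>A rational algebraic integer is an integer. This is the final contradiction of the
  divisibility argument.\<close>

lemma odd_half_notin_int_adjoin:
  assumes "w ^ N = 1" "N > 0" "odd m"
  shows "of_int m / 2 \<notin> int_adjoin w"
proof
  assume "of_int m / 2 \<in> int_adjoin w"
  then have "algebraic_int (of_int m / 2 :: complex)"
    using algebraic_int_int_adjoin assms by blast
  then have "(of_int m / 2 :: complex) \<in> \<int>"
    by (intro rational_algebraic_int_is_int) auto
  then obtain n where "of_int m / 2 = (of_int n :: complex)" by (auto elim: Ints_cases)
  then have "(of_int m :: complex) = of_int (2 * n)" by (simp add: field_simps)
  then have "m = 2 * n" by (simp only: of_int_eq_iff)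
  then show False using assms by simp
qed

section \<open>Divisors of the form 1 - u for roots of unity u\<close>

lemma one_minus_dvd_one_minus_power:
  assumes "u \<in> int_adjoin w"
  shows "\<exists>c\<in>int_adjoin w. (1 - u) * c = 1 - u ^ n"
  by (rule bexI[of _ "\<Sum>i<n. u ^ i"])
    (auto simp: one_diff_power_eq intro!: int_adjoin_intros assms)

text \<open>Each \<open>1 - u ^ i\<close> with \<open>i < q\<close> is a multiple of
  \<open>1 - u\<close>. Their sum is \<open>q\<close>, because the geometric sum of a nontrivial
  \<open>q\<close>-th root of unity vanishes.\<close>

lemma one_minus_dvd_of_power_eq_1:
  assumes "u \<in> int_adjoin w" "u ^ q = 1" "u \<noteq> 1"
  shows "\<exists>c\<in>int_adjoin w. (1 - u) * c = of_nat q"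
proof (rule bexI)
  have "(1 - u) * (\<Sum>i<q. \<Sum>k<i. u ^ k) = (\<Sum>i<q. 1 - u ^ i)"
    by (simp add: sum_distrib_left one_diff_power_eq)
  also have "\<dots> = of_nat q - (\<Sum>i<q. u ^ i)" by (simp add: sum_subtractf)
  also have "(\<Sum>i<q. u ^ i) = 0" using one_diff_power_eq[of u q] assms by simp
  finally show "(1 - u) * (\<Sum>i<q. \<Sum>k<i. u ^ k) = of_nat q" by simp
qed (intro int_adjoin_intros assms)

text \<open>Repeated squaring ends in 1; the last value before that is a square root of 1 other than
  1.\<close>

lemma power2_chain_minus_one:
  fixes z :: complex
  assumes "z ^ (2 ^ e) = 1" "z \<noteq> 1"
  shows "\<exists>i. z ^ (2 ^ i) = -1"
  using assms
proof (induction e arbitrary: z)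
  case (Suc e)
  show ?case
  proof (cases "z\<^sup>2 = 1")
    case True
    then have "z ^ 2 ^ 0 = -1" using Suc.prems(2) by (auto simp: power2_eq_1_iff)
    then show ?thesis by blast
  next
    case False
    then obtain i where "(z\<^sup>2) ^ 2 ^ i = -1"
      using Suc.IH[of "z\<^sup>2"] Suc.prems(1) by (auto simp: power_mult[symmetric])
    then have "z ^ 2 ^ Suc i = -1" by (simp add: power_mult[symmetric])
    then show ?thesis by blast
  qed
qed simp

text \<open>The 2-adic valuation of \<open>1 - u\<close> is \<open>1 / \<phi>(2 ^ e)\<close> if \<open>u\<close> has order \<open>2 ^ e\<close> and zero
  if the order of \<open>u\<close> is not a power of 2; so it is at most \<open>1/4\<close> unless the order is 1, 2 or 4.\<close>

lemma one_minus_power4_dvd_twice_odd: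
  assumes u: "u \<in> int_adjoin w" and N: "u ^ N = 1" "N > 0" and u4: "u ^ 4 \<noteq> 1"
  shows "\<exists>c\<in>int_adjoin w. \<exists>q::nat. odd q \<and> (1 - u) ^ 4 * c = 2 * of_nat q"
proof -
  obtain e q where Nq: "N = 2 ^ e * q" and q: "odd q"
    using N(2) by (rule_tac multiplicity_decompose'[of N 2]) auto
  show ?thesis
  proof (cases "u ^ 2 ^ e = 1")
    \<comment> \<open>Here \<open>u ^ 2 ^ e\<close> is a nontrivial \<open>q\<close>-th root of
      unity, so \<open>1 - u\<close> divides the odd number \<open>q\<close>; the factor 2 is
      padding.\<close>
    case False
    obtain c where c: "c \<in> int_adjoin w" "(1 - u) * c = 1 - u ^ 2 ^ e"
      using one_minus_dvd_one_minus_power u by blast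
    obtain d where d: "d \<in> int_adjoin w" "(1 - u ^ 2 ^ e) * d = of_nat q"
      using one_minus_dvd_of_power_eq_1[of "u ^ 2 ^ e" w q] False N(1) u
      by (auto simp: Nq power_mult int_adjoin_power)
    have "(1 - u) ^ 4 * (2 * (c * d) ^ 4) = 2 * ((1 - u) * c * d) ^ 4"
      by (simp add: power_mult_distrib mult_ac)
    also have "\<dots> = 2 * of_nat (q ^ 4)" by (simp add: c d)
    finally show ?thesis using c(1) d(1) q
      by (intro bexI[of _ "2 * (c * d) ^ 4"] exI[of _ "q ^ 4"])
        (auto intro!: int_adjoin_intros)
  next
    case True
    then have "(u ^ 4) ^ 2 ^ e = 1" by (metis power_mult mult.commute power_one)
    then obtain i where i: "(u ^ 4) ^ 2 ^ i = -1" using power2_chain_minus_one u4 by blast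
    \<comment> \<open>A power of \<open>u\<close> that is a primitive 8th root of unity.\<close>
    define k where "k = u ^ 2 ^ i"
    have k4: "k ^ 4 = -1" using i by (simp add: k_def power_mult[symmetric] mult.commute)
    have kin: "k \<in> int_adjoin w" using u by (auto simp: k_def intro: int_adjoin_power)
    obtain c where c: "c \<in> int_adjoin w" "(1 - u) * c = 1 - k"
      using one_minus_dvd_one_minus_power u unfolding k_def by blast
    \<comment> \<open>Put \<open>s = k + 1/k\<close>. From \<open>k ^ 4 = -1\<close> follow
      \<open>1/k = - (k ^ 3)\<close>, \<open>s ^ 2 = 2\<close> and
      \<open>(1 - k) ^ 4 = 2 * k ^ 2 * (3 - 2 * s)\<close>. The cofactor of 2 is a unit, with
      inverse \<open>d = - (k ^ 2) * (3 + 2 * s)\<close>.\<close>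
    define d where "d = - (k\<^sup>2) * (3 + 2 * k - 2 * k ^ 3)"
    have "(1 - k) ^ 4 * d = 2 + (k ^ 4 + 1) * (2 * k ^ 5 - 8 * k ^ 4 + 10 * k ^ 3 - 3 * k\<^sup>2 - 2)"
      by (simp add: d_def eval_nat_numeral algebra_simps)
    then have "(1 - k) ^ 4 * d = 2" by (simp add: k4)
    then have "(1 - u) ^ 4 * (c ^ 4 * d) = 2 * of_nat 1"
      by (simp add: c(2)[symmetric] power_mult_distrib mult_ac)
    moreover have "d \<in> int_adjoin w" unfolding d_def by (intro int_adjoin_intros kin)
    ultimately show ?thesis using c(1)
      by (intro bexI[of _ "c ^ 4 * d"] exI[of _ 1]) (auto intro!: int_adjoin_intros)
  qed
qed

text \<open>The 2-adic valuations of \<open>1 - u\<close> and \<open>1 - v\<close> are at most 1/4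
  and 1/2, so their sum is below the valuation 1 of 2. Fourth powers clear the fractions: membership
  would put half of an odd number into the ring.\<close>

lemma half_product_notin_int_adjoin:
  assumes w: "w ^ M = 1" "M > 0"
    and u: "u \<in> int_adjoin w" "u ^ N = 1" "N > 0" "u ^ 4 \<noteq> 1"
    and v: "v \<in> int_adjoin w" "v ^ N = 1" "v\<^sup>2 \<noteq> 1"
  shows "(1 - u) * (1 - v) / 2 \<notin> int_adjoin w"
proof
  define z where "z = (1 - u) * (1 - v) / 2"
  assume "(1 - u) * (1 - v) / 2 \<in> int_adjoin w"
  then have z: "z \<in> int_adjoin w" by (simp add: z_def)
  obtain c p where c: "c \<in> int_adjoin w" "(1 - u) ^ 4 * c = 2 * of_nat p" "odd p"
    using one_minus_power4_dvd_twice_odd u by blast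
  obtain d q where d: "d \<in> int_adjoin w" "(1 - v) ^ 4 * d = 4 * of_nat q" "odd q"
  proof (cases "v ^ 4 = 1")
    case False
    then obtain d q where "d \<in> int_adjoin w" "(1 - v) ^ 4 * d = 2 * of_nat q" "odd q"
      using one_minus_power4_dvd_twice_odd v u(3) by blast
    then show ?thesis using that[of "2 * d" q]
      by (simp add: mult.left_commute int_adjoin_mult)
  next
    \<comment> \<open>Now \<open>v\<close> is a primitive 4th root of unity, so
      \<open>(1 - v) ^ 2 = - 2 * v\<close> and \<open>(1 - v) ^ 4 = -4\<close>.\<close>
    case True
    then have "(v\<^sup>2)\<^sup>2 = 1" by (simp add: power_mult[symmetric])
    then have "v\<^sup>2 = -1" using v(3) by (metis power2_eq_1_iff)
    moreover have "(1 - v) ^ 4 = (1 - 2 * v + v\<^sup>2)\<^sup>2"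
      by (simp add: eval_nat_numeral algebra_simps)
    ultimately have "(1 - v) ^ 4 * -1 = 4 * of_nat 1" by (simp add: power_mult_distrib)
    then show ?thesis using that[of "-1" 1] by (auto intro!: int_adjoin_intros)
  qed
  have "16 * (z ^ 4 * (c * d)) = ((1 - u) ^ 4 * c) * ((1 - v) ^ 4 * d)"
    by (simp add: z_def power_mult_distrib power_divide)
  also have "\<dots> = 8 * of_int (int (p * q))" unfolding c(2) d(2) by simp
  finally have "of_int (int (p * q)) / 2 = z ^ 4 * (c * d)" by (simp add: mult_ac)
  moreover have "z ^ 4 * (c * d) \<in> int_adjoin w" using z c d by (auto intro!: int_adjoin_intros)
  moreover have "odd (int (p * q))" using c d by simp
  ultimately show False using odd_half_notin_int_adjoin[OF w] by metis
qed

section \<open>Rational angles and sums of two cosines\<close>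

lemma cis_in_int_adjoin:
  assumes "N > 0"
  shows "cis (2 * pi * of_int k / of_nat N) \<in> int_adjoin (cis (2 * pi / of_nat N))"
proof -
  \<comment> \<open>\<open>k\<close> may be negative, while elements of the ring are polynomials in
    the generator; reduction modulo \<open>N\<close> gives a natural exponent.\<close>
  define r where "r = nat (k mod int N)"
  have k: "k = int r + int N * (k div int N)" using assms by (simp add: r_def)
  have "2 * pi * of_int k / of_nat N = real r * (2 * pi / of_nat N) + 2 * pi * of_int (k div int N)"
    using assms by (subst k) (simp add: field_simps)
  then have "cis (2 * pi * of_int k / of_nat N) = cis (2 * pi / of_nat N) ^ r"
    by (simp add: cis_mult[symmetric] DeMoivre cis_multiple_2pi)
  then show ?thesis by (simp add: int_adjoin_power int_adjoin_generator)
qed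

lemma cis_2pi_div_eq_1_iff:
  fixes l k :: int
  assumes "l > 0"
  shows "cis (2 * pi * of_int k / of_int l) = 1 \<longleftrightarrow> l dvd k"
proof
  assume "cis (2 * pi * of_int k / of_int l) = 1"
  then have "cos (2 * pi * of_int k / of_int l) = 1" by (simp add: complex_eq_iff)
  then obtain n :: int where "2 * pi * of_int k / of_int l = of_int n * 2 * pi"
    using cos_one_2pi_int by metis
  then have "(of_int k :: real) = of_int (n * l)" using assms by (simp add: field_simps)
  then show "l dvd k" by (simp only: of_int_eq_iff) simp
next
  assume "l dvd k"
  then obtain n where "k = l * n" by blast
  then have "2 * pi * of_int k / of_int l = 2 * pi * of_int n" using assms by simp
  then show "cis (2 * pi * of_int k / of_int l) = 1" by (simp add: cis_multiple_2pi)
qed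

text \<open>The vanishing sine makes \<open>cis \<theta>\<close> a root of unity, so
  \<open>2 * cos \<theta>\<close> lies in a ring generated by a root of unity. Up to a unit it is
  half of a product of two factors \<open>1 - U c\<close>, which for \<open>a + b \<noteq> l\<close>
  is too divisible by 2 only if both \<open>U c\<close> have order 4, and that forces
  \<open>a = b\<close>.\<close>

lemma sum_eq_of_cos_pi_rational:
  fixes l a b :: int and \<tau> :: nat and \<theta> :: real
  assumes ab: "a \<in> {1..l-1}" "b \<in> {1..l-1}" "a \<noteq> b" and \<tau>: "\<tau> > 0"
    and \<theta>: "2 * cos \<theta> = cos (pi * a / l) + cos (pi * b / l)" "sin (\<tau> * \<theta>) = 0"
  shows "a + b = l"
proof (rule ccontr)
  assume nl: "a + b \<noteq> l"
  have l: "l > 0" using ab by auto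
  \<comment> \<open>A common multiple of \<open>2 * l\<close> and \<open>2 * \<tau>\<close>, so that
    the ring of \<open>w\<close> contains both \<open>cis (pi * k / l)\<close> and
    \<open>cis (s * \<theta>)\<close>.\<close>
  define N where "N = 4 * nat l * \<tau>"
  define w where "w = cis (2 * pi / of_nat N)"
  have N: "N > 0" using l \<tau> by (simp add: N_def)
  have w: "w ^ N = 1" using N by (simp add: w_def DeMoivre)
  obtain m :: int where m: "\<tau> * \<theta> = m * pi" using \<theta>(2) sin_zero_iff_int2 by blast
  have ring: "cis (pi * of_int k / of_int l) \<in> int_adjoin w" for k
  proof -
    have "pi * of_int k / of_int l = 2 * pi * of_int (2 * int \<tau> * k) / of_nat N"
      using l \<tau> by (simp add: N_def field_simps)
    then show ?thesis unfolding w_def using cis_in_int_adjoin[OF N] by metis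
  qed
  have ring\<theta>: "cis (of_int s * \<theta>) \<in> int_adjoin w" for s
  proof -
    have "of_int s * \<theta> = 2 * pi * of_int (2 * l * s * m) / of_nat N"
      using l \<tau> m by (simp add: N_def field_simps)
    then show ?thesis unfolding w_def using cis_in_int_adjoin[OF N] by metis
  qed
  \<comment> \<open>The sign turns the factors \<open>1 + cis (pi * c / l)\<close> into the form
    \<open>1 - U c\<close> of the divisibility lemmas.\<close>
  define U where "U c = - cis (pi * of_int c / of_int l)" for c
  have U2: "(U c)\<^sup>2 = cis (2 * pi * of_int c / of_int l)" for c
    by (simp add: U_def DeMoivre mult_ac)
  have U4: "(U c) ^ 4 = cis (2 * pi * of_int (2 * c) / of_int l)" for c
    by (simp add: U_def DeMoivre mult_ac)
  have UN: "(U c) ^ N = 1" for c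
  proof -
    have "(U c) ^ N = ((U c)\<^sup>2) ^ (2 * nat l * \<tau>)"
      by (simp add: N_def power_mult[symmetric] mult_ac)
    also have "\<dots> = cis (2 * pi * of_int (2 * \<tau> * c))"
      unfolding U2 DeMoivre using l by (simp add: field_simps)
    finally show ?thesis by (simp only: cis_multiple_2pi Ints_of_int)
  qed
  have Uin: "U c \<in> int_adjoin w" for c unfolding U_def by (intro int_adjoin_intros ring)
  have ndvd: "\<not> l dvd a + b" "\<not> l dvd a - b"
  proof -
    show "\<not> l dvd a + b"
    proof
      assume "l dvd a + b"
      then obtain k where k: "a + b = l * k" by blast
      have "0 < l * k" "l * k < l * 2" unfolding k[symmetric] using ab by auto
      then have "k = 1" using l by (simp add: zero_less_mult_iff)
      then show False using nl k by simp
    qed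
    show "\<not> l dvd a - b"
      using ab zdvd_not_zless[of "a - b" l] zdvd_not_zless[of "b - a" l] dvd_diff_commute[of l a b]
      by (cases "a < b") auto
  qed
  have sq: "(U (a + b))\<^sup>2 \<noteq> 1" "(U (a - b))\<^sup>2 \<noteq> 1"
    unfolding U2 cis_2pi_div_eq_1_iff[OF l] using ndvd by auto
  \<comment> \<open>With \<zeta> = \<open>cis (pi / l)\<close>, multiplication by the unit \<zeta>^a
    turns the four exponentials into 1 + \<zeta>^(2a) + \<zeta>^(a+b) + \<zeta>^(a-b), which factors
    as (1 + \<zeta>^(a+b)) (1 + \<zeta>^(a-b)).\<close>
  have "cis (pi * a / l) * (cis \<theta> + cis (- \<theta>)) = cis (pi * a / l) * of_real (2 * cos \<theta>)"
    by (simp add: complex_eq_iff)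
  also have "\<dots> = cis (pi * a / l) *
      ((cis (pi * a / l) + cis (- (pi * a / l)) + cis (pi * b / l) + cis (- (pi * b / l))) / 2)"
    unfolding \<theta>(1) by (simp add: complex_eq_iff)
  also have "\<dots> = (1 - U (a + b)) * (1 - U (a - b)) / 2"
    by (simp add: U_def cis_mult algebra_simps add_divide_distrib diff_divide_distrib)
  finally have "(1 - U (a + b)) * (1 - U (a - b)) / 2 = cis (pi * a / l) * (cis \<theta> + cis (- \<theta>))"
    by simp
  moreover have "cis (pi * a / l) * (cis \<theta> + cis (- \<theta>)) \<in> int_adjoin w"
    using ring[of a] ring\<theta>[of 1] ring\<theta>[of "-1"] by (auto intro!: int_adjoin_intros)
  ultimately have half: "(1 - U (a + b)) * (1 - U (a - b)) / 2 \<in> int_adjoin w" by simp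
  have "U (a + b) ^ 4 = 1"
    using half_product_notin_int_adjoin[OF w N Uin UN N _ Uin UN sq(2)] half by blast
  moreover have "U (a - b) ^ 4 = 1"
    using half_product_notin_int_adjoin[OF w N Uin UN N _ Uin UN sq(1)] half
    by (metis mult.commute)
  ultimately have "((U (a + b))\<^sup>2)\<^sup>2 = 1" "((U (a - b))\<^sup>2)\<^sup>2 = 1" by (simp_all add: power_mult[symmetric])
  then have i: "(U (a + b))\<^sup>2 = -1" "(U (a - b))\<^sup>2 = -1"
    using sq by (metis power2_eq_1_iff)+
  \<comment> \<open>Both squares are -1, so their product \<zeta>^(4a) and quotient \<zeta>^(4b) are
    1. Hence \<open>l\<close> divides \<open>2 * a\<close> and \<open>2 * b\<close>, and the range
    of \<open>a\<close> and \<open>b\<close> makes both equal to \<open>l\<close>.\<close>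
  have "cis (2 * pi * of_int (2 * a) / of_int l) = (U (a + b))\<^sup>2 * (U (a - b))\<^sup>2"
    unfolding U2 cis_mult by (rule arg_cong[of _ _ cis]) (use l in \<open>simp add: field_simps\<close>)
  then have "l dvd 2 * a" unfolding i by (simp add: cis_2pi_div_eq_1_iff[OF l, symmetric])
  moreover have "cis (2 * pi * of_int (2 * b) / of_int l) = (U (a + b))\<^sup>2 / (U (a - b))\<^sup>2"
    unfolding U2 cis_divide by (rule arg_cong[of _ _ cis]) (use l in \<open>simp add: field_simps\<close>)
  then have "l dvd 2 * b" unfolding i by (simp add: cis_2pi_div_eq_1_iff[OF l, symmetric])
  moreover have "2 * c = l" if c: "l dvd 2 * c" "c \<in> {1..l-1}" for c
  proof -
    obtain k where k: "2 * c = l * k" using c(1) by blast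
    have "0 < l * k" "l * k < l * 2" unfolding k[symmetric] using c by auto
    then have "k = 1" using l by (simp add: zero_less_mult_iff)
    then show ?thesis using k by simp
  qed
  ultimately have "2 * a = l" "2 * b = l" using ab by auto
  then show False using ab by simp
qed

subsection \<open>Grover walks on regular graphs\<close>

locale regular_graph =
  fixes V :: "'v set" and E :: "'v \<Rightarrow> 'v \<Rightarrow> bool" and k :: nat
  assumes finite_V: "finite V" and sym_E: "E u v \<Longrightarrow> E v u"
    and regular: "regular V E k" and k_pos: "k > 0"
begin

definition nbrs :: "'v \<Rightarrow> 'v set" where
  "nbrs u = {v \<in> V. E u v}"

text \<open>On vertices this is sqrt \<open>k\<close> times the boundary matrix d applied to
  \<open>\<phi>\<close>; \<open>outflow\<close> is the same for R \<open>\<phi>\<close>.\<close>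

definition inflow :: "('v \<times> 'v \<Rightarrow> complex) \<Rightarrow> 'v \<Rightarrow> complex" where
  "inflow \<phi> u = (\<Sum>z\<in>nbrs u. \<phi> (z, u))"

definition outflow :: "('v \<times> 'v \<Rightarrow> complex) \<Rightarrow> 'v \<Rightarrow> complex" where
  "outflow \<phi> u = (\<Sum>z\<in>nbrs u. \<phi> (u, z))"

definition walk :: "('v \<times> 'v \<Rightarrow> complex) \<Rightarrow> 'v \<times> 'v \<Rightarrow> complex" where
  "walk = mat_vec (arcs V E) (evol V E)"

lemma finite_nbrs [simp]: "finite (nbrs u)"
  using finite_V by (simp add: nbrs_def)

lemma nbrsD: "v \<in> nbrs u \<Longrightarrow> v \<in> V" "v \<in> nbrs u \<Longrightarrow> E u v"
  by (auto simp: nbrs_def)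

lemma nbrs_sym: "u \<in> V \<Longrightarrow> v \<in> nbrs u \<Longrightarrow> u \<in> nbrs v"
  using sym_E by (auto simp: nbrs_def)

lemma arcs_eq: "arcs V E = (SIGMA u:V. nbrs u)"
  by (auto simp: arcs_def nbrs_def)

lemma finite_arcs: "finite (arcs V E)"
  using finite_V by (auto simp: arcs_eq)

lemma arc_iff: "(u, v) \<in> arcs V E \<longleftrightarrow> u \<in> V \<and> v \<in> nbrs u"
  by (auto simp: arcs_eq)

lemma arc_into: "u \<in> V \<Longrightarrow> z \<in> nbrs u \<Longrightarrow> (z, u) \<in> arcs V E"
  using nbrs_sym by (auto simp: arc_iff nbrs_def)

lemma gdeg_eq: "u \<in> V \<Longrightarrow> gdeg V E u = k"
  using regular by (simp add: regular_def)

lemma card_nbrs: "u \<in> V \<Longrightarrow> card (nbrs u) = k"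
  using gdeg_eq by (simp add: gdeg_def nbrs_def)

text \<open>Both sides run over all arcs, and reversal permutes the arcs. With a factor depending on
  one endpoint, this is self-adjointness of the adjacency matrix.\<close>

lemma sum_nbrs_swap:
  "(\<Sum>u\<in>V. \<Sum>v\<in>nbrs u. f u v) = (\<Sum>v\<in>V. \<Sum>u\<in>nbrs v. f u v)"
proof -
  have "(\<Sum>u\<in>V. \<Sum>v\<in>nbrs u. f u v) = (\<Sum>(u, v)\<in>arcs V E. f u v)"
    unfolding arcs_eq by (rule sum.Sigma) (auto simp: finite_V)
  also have "\<dots> = (\<Sum>(v, u)\<in>arcs V E. f u v)"
    by (rule sum.reindex_bij_witness[of _ prod.swap prod.swap])
      (auto simp: arc_iff nbrs_sym dest: nbrsD)
  also have "\<dots> = (\<Sum>v\<in>V. \<Sum>u\<in>nbrs v. f u v)"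
    unfolding arcs_eq by (rule sum.Sigma[symmetric]) (auto simp: finite_V)
  finally show ?thesis .
qed

lemma sqrt_mult: "of_real (sqrt k) * of_real (sqrt k) = (of_nat k :: complex)"
  by (simp add: of_real_mult[symmetric] del: of_real_mult)

lemma dstar_d_eq:
  assumes "v \<in> V"
  shows "dstar_d V E (u, v) b = (if v = snd b then 1 / of_nat k else 0)"
proof -
  have "dstar_d V E (u, v) b = (\<Sum>x\<in>V. if x = v then cnj (bdry V E v (u, v)) * bdry V E v b else 0)"
    unfolding dstar_d_def by (rule sum.cong) (auto simp: bdry_def)
  also have "\<dots> = cnj (bdry V E v (u, v)) * bdry V E v b" using assms finite_V by simp
  also have "\<dots> = (if v = snd b then of_real (1 / sqrt k * (1 / sqrt k)) else 0)"
    using assms by (auto simp: bdry_def gdeg_eq sqrt_mult)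
  also have "1 / sqrt k * (1 / sqrt k) = 1 / k" by simp
  finally show ?thesis by simp
qed

lemma evol_eq:
  assumes "(u, v) \<in> arcs V E"
  shows "evol V E (u, v) b =
    2 * (if u = snd b then 1 / of_nat k else 0) - (if b = (v, u) then 1 else 0)"
proof -
  have vu: "(v, u) \<in> arcs V E" and u: "u \<in> V" using assms sym_E by (auto simp: arcs_def)
  have "evol V E (u, v) b = (\<Sum>c\<in>arcs V E. if c = (v, u) then
      2 * dstar_d V E (v, u) b - (if (v, u) = b then 1 else 0) else 0)"
    unfolding evol_def by (rule sum.cong) (auto simp: shift_def)
  also have "\<dots> = 2 * dstar_d V E (v, u) b - (if (v, u) = b then 1 else 0)"
    using vu finite_arcs by simp
  finally show ?thesis using u by (auto simp: dstar_d_eq)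
qed

text \<open>The Grover coin: the amplitudes entering \<open>u\<close> are reflected about their
  mean, then the arcs are reversed.\<close>

lemma walk_eq:
  assumes "(u, v) \<in> arcs V E"
  shows "walk \<phi> (u, v) = 2 / of_nat k * inflow \<phi> u - \<phi> (v, u)"
proof -
  have vu: "(v, u) \<in> arcs V E" and u: "u \<in> V" using assms sym_E by (auto simp: arcs_def)
  have arcs_u: "{b \<in> arcs V E. u = snd b} = (\<lambda>z. (z, u)) ` nbrs u"
    using u by (auto simp: arc_iff nbrs_sym dest: nbrsD)
  have "walk \<phi> (u, v) = (\<Sum>b\<in>arcs V E. (if u = snd b then 2 / of_nat k * \<phi> b else 0)
      - (if b = (v, u) then \<phi> b else 0))"
    unfolding walk_def mat_vec_def by (rule sum.cong) (auto simp: evol_eq[OF assms] algebra_simps)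
  also have "\<dots> = (\<Sum>b\<in>{b \<in> arcs V E. u = snd b}. 2 / of_nat k * \<phi> b) - \<phi> (v, u)"
    using vu finite_arcs by (simp add: sum_subtractf sum.inter_filter cong: if_cong)
  also have "(\<Sum>b\<in>{b \<in> arcs V E. u = snd b}. 2 / of_nat k * \<phi> b) = 2 / of_nat k * inflow \<phi> u"
    unfolding arcs_u inflow_def by (subst sum.reindex) (auto simp: inj_on_def sum_distrib_left)
  finally show ?thesis .
qed

lemma inflow_walk:
  assumes "u \<in> V"
  shows "inflow (walk \<phi>) u = 2 / of_nat k * (\<Sum>z\<in>nbrs u. inflow \<phi> z) - outflow \<phi> u"
proof -
  have "inflow (walk \<phi>) u = (\<Sum>z\<in>nbrs u. 2 / of_nat k * inflow \<phi> z - \<phi> (u, z))"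
    unfolding inflow_def[of "walk \<phi>"] using assms
    by (intro sum.cong refl walk_eq) (auto simp: arc_into)
  then show ?thesis by (simp add: sum_subtractf sum_distrib_left outflow_def)
qed

text \<open>The outflow is the inflow one step earlier. This turns \<open>inflow_walk\<close> into a
  three-term recurrence.\<close>

lemma outflow_walk:
  assumes "u \<in> V"
  shows "outflow (walk \<phi>) u = inflow \<phi> u"
proof -
  have "outflow (walk \<phi>) u = (\<Sum>z\<in>nbrs u. 2 / of_nat k * inflow \<phi> u - \<phi> (z, u))"
    unfolding outflow_def using assms
    by (intro sum.cong refl walk_eq) (auto simp: arc_iff)
  also have "\<dots> = 2 * inflow \<phi> u - inflow \<phi> u"
    using assms k_pos by (simp add: sum_subtractf inflow_def card_nbrs)
  finally show ?thesis by simp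
qed

section \<open>Norm preservation and perfect state transfer in terms of the inflow\<close>

definition norm2 :: "('v \<times> 'v \<Rightarrow> complex) \<Rightarrow> complex" where
  "norm2 \<phi> = (\<Sum>u\<in>V. \<Sum>z\<in>nbrs u. \<phi> (z, u) * cnj (\<phi> (z, u)))"

text \<open>Unitarity of U: arc reversal permutes the entries, and at each vertex the coin is a
  reflection, so the terms containing the inflow cancel.\<close>

lemma norm2_walk: "norm2 (walk \<phi>) = norm2 \<phi>"
proof -
  have "norm2 (walk \<phi>) = (\<Sum>u\<in>V. \<Sum>z\<in>nbrs u. walk \<phi> (u, z) * cnj (walk \<phi> (u, z)))"
    unfolding norm2_def by (rule sum_nbrs_swap)
  also have "\<dots> = norm2 \<phi>"
    unfolding norm2_def
  proof (rule sum.cong)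
    fix u assume u: "u \<in> V"
    let ?S = "inflow \<phi> u"
    have e: "(\<Sum>z\<in>nbrs u. c) = of_nat k * c" "(\<Sum>z\<in>nbrs u. c * \<phi> (z, u)) = c * ?S"
      "(\<Sum>z\<in>nbrs u. c * cnj (\<phi> (z, u))) = c * cnj ?S" for c
      using u by (simp_all add: card_nbrs inflow_def sum_distrib_left)
    have "(\<Sum>z\<in>nbrs u. walk \<phi> (u, z) * cnj (walk \<phi> (u, z))) =
        (\<Sum>z\<in>nbrs u. (2 / of_nat k * ?S - \<phi> (z, u)) * cnj (2 / of_nat k * ?S - \<phi> (z, u)))"
      using u by (intro sum.cong refl) (simp add: walk_eq arc_iff)
    also have "\<dots> = (\<Sum>z\<in>nbrs u. 4 / (of_nat k)\<^sup>2 * ?S * cnj ?S - 2 / of_nat k * ?S * cnj (\<phi> (z, u))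
        - 2 / of_nat k * cnj ?S * \<phi> (z, u) + \<phi> (z, u) * cnj (\<phi> (z, u)))"
      by (intro sum.cong refl) (simp add: algebra_simps power2_eq_square)
    also have "\<dots> = of_nat k * (4 / (of_nat k)\<^sup>2 * ?S * cnj ?S) - 2 / of_nat k * ?S * cnj ?S
        - 2 / of_nat k * cnj ?S * ?S + (\<Sum>z\<in>nbrs u. \<phi> (z, u) * cnj (\<phi> (z, u)))"
      by (simp only: sum.distrib sum_subtractf e)
    also have "\<dots> = (\<Sum>z\<in>nbrs u. \<phi> (z, u) * cnj (\<phi> (z, u)))"
      using k_pos by (simp add: field_simps power2_eq_square)
    finally show "(\<Sum>z\<in>nbrs u. walk \<phi> (u, z) * cnj (walk \<phi> (u, z))) =
        (\<Sum>z\<in>nbrs u. \<phi> (z, u) * cnj (\<phi> (z, u)))" .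
  qed simp
  finally show ?thesis .
qed

lemma evolve_0: "evolve V E 0 \<phi> = \<phi>"
  and evolve_Suc: "evolve V E (Suc t) \<phi> = walk (evolve V E t \<phi>)"
  by (simp_all add: evolve_def walk_def)

lemma norm2_evolve: "norm2 (evolve V E t \<phi>) = norm2 \<phi>"
  by (induction t) (simp_all add: evolve_0 evolve_Suc norm2_walk)

lemma vstate_eq: "u \<in> V \<Longrightarrow> vstate V E u (z, v) = (if u = v then of_real (1 / sqrt k) else 0)"
  by (auto simp: vstate_def bdry_def gdeg_eq)

lemma inflow_vstate:
  assumes "x \<in> V" "u \<in> V"
  shows "inflow (vstate V E x) u = (if u = x then of_real (sqrt k) else 0)"
proof -
  have "inflow (vstate V E x) u = (if u = x then of_nat k * of_real (1 / sqrt k) else 0)"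
    using assms by (auto simp: inflow_def vstate_eq card_nbrs)
  also have "of_nat k * of_real (1 / sqrt k) = (of_real (k * (1 / sqrt k)) :: complex)" by simp
  also have "k * (1 / sqrt k) = sqrt k" by (simp add: real_div_sqrt)
  finally show ?thesis .
qed

lemma norm2_vstate:
  assumes "x \<in> V"
  shows "norm2 (vstate V E x) = 1"
proof -
  have "norm2 (vstate V E x) = (\<Sum>u\<in>V. if u = x then 1 else 0)"
    unfolding norm2_def using assms k_pos
    by (intro sum.cong refl) (auto simp: vstate_eq card_nbrs sqrt_mult)
  then show ?thesis using assms finite_V by simp
qed

text \<open>The inflow at \<open>y\<close> is, up to a factor, the inner product with the vertex type state of \<open>y\<close>; so the
  nontrivial direction is the equality case of the Cauchy--Schwarz inequality.\<close>

lemma PST_vstate_iff: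
  assumes x: "x \<in> V" and y: "y \<in> V"
  shows "PST V E (vstate V E x) (vstate V E y) t \<longleftrightarrow> x \<noteq> y \<and> t \<ge> 1 \<and>
    (\<exists>\<gamma>. cmod \<gamma> = 1 \<and> (\<forall>v\<in>V. inflow (evolve V E t (vstate V E x)) v =
      (if v = y then \<gamma> * of_real (sqrt k) else 0)))"
    (is "_ \<longleftrightarrow> _ \<and> _ \<and> (\<exists>\<gamma>. _ \<and> ?I \<gamma>)")
proof -
  let ?\<phi> = "evolve V E t (vstate V E x)"
  have distinct: "(\<exists>a\<in>arcs V E. vstate V E x a \<noteq> vstate V E y a) \<longleftrightarrow> x \<noteq> y"
  proof
    assume "x \<noteq> y"
    obtain u where "u \<in> nbrs x" using card_nbrs[OF x] k_pos by fastforce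
    then have "(u, x) \<in> arcs V E" using x by (rule_tac arc_into)
    moreover have "vstate V E x (u, x) \<noteq> vstate V E y (u, x)"
      using x y \<open>x \<noteq> y\<close> k_pos by (simp add: vstate_eq)
    ultimately show "\<exists>a\<in>arcs V E. vstate V E x a \<noteq> vstate V E y a" by blast
  qed auto
  have "(\<forall>a\<in>arcs V E. ?\<phi> a = \<gamma> * vstate V E y a) \<longleftrightarrow> ?I \<gamma>" if \<gamma>: "cmod \<gamma> = 1" for \<gamma>
  proof
    assume "\<forall>a\<in>arcs V E. ?\<phi> a = \<gamma> * vstate V E y a"
    then have "inflow ?\<phi> v = \<gamma> * inflow (vstate V E y) v" if "v \<in> V" for v
      unfolding inflow_def sum_distrib_left using that
      by (intro sum.cong) (auto simp: arc_into)
    then show "?I \<gamma>" using y by (simp add: inflow_vstate)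
  next
    assume I: "?I \<gamma>"
    let ?d = "\<lambda>a. ?\<phi> a - \<gamma> * vstate V E y a"
    have \<gamma>1: "\<gamma> * cnj \<gamma> = 1" using \<gamma> by (simp add: complex_norm_square[symmetric])
    \<comment> \<open>Both squared norms are 1, and both cross terms are 1 because the inflow at
      \<open>y\<close> is \<open>\<gamma> * sqrt k\<close>; the total is 1 + 1 - 1 - 1.\<close>
    have "norm2 ?d = norm2 ?\<phi> + (\<gamma> * cnj \<gamma>) * norm2 (vstate V E y)
        - (\<Sum>u\<in>V. \<Sum>z\<in>nbrs u. ?\<phi> (z, u) * cnj (\<gamma> * vstate V E y (z, u)))
        - (\<Sum>u\<in>V. \<Sum>z\<in>nbrs u. cnj (?\<phi> (z, u)) * (\<gamma> * vstate V E y (z, u)))"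
      unfolding norm2_def sum_distrib_left sum.distrib[symmetric] sum_subtractf[symmetric]
      by (intro sum.cong refl) (simp add: algebra_simps)
    also have "(\<Sum>u\<in>V. \<Sum>z\<in>nbrs u. ?\<phi> (z, u) * cnj (\<gamma> * vstate V E y (z, u)))
        = (\<Sum>u\<in>V. if u = y then inflow ?\<phi> y * cnj \<gamma> * of_real (1 / sqrt k) else 0)"
      using y by (intro sum.cong refl) (auto simp: vstate_eq inflow_def sum_distrib_right sum_divide_distrib)
    also have "\<dots> = inflow ?\<phi> y * cnj \<gamma> * of_real (1 / sqrt k)" using y finite_V by simp
    also have "\<dots> = 1" using I y k_pos \<gamma>1 by simp
    also have "(\<Sum>u\<in>V. \<Sum>z\<in>nbrs u. cnj (?\<phi> (z, u)) * (\<gamma> * vstate V E y (z, u)))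
        = (\<Sum>u\<in>V. if u = y then cnj (inflow ?\<phi> y) * \<gamma> * of_real (1 / sqrt k) else 0)"
      using y by (intro sum.cong refl) (auto simp: vstate_eq inflow_def sum_distrib_right sum_divide_distrib)
    also have "\<dots> = cnj (inflow ?\<phi> y) * \<gamma> * of_real (1 / sqrt k)" using y finite_V by simp
    also have "\<dots> = 1" using I y k_pos \<gamma>1 by (simp add: mult_ac)
    finally have "norm2 ?d = 0" using x y \<gamma>1 by (simp add: norm2_evolve norm2_vstate)
    moreover have "norm2 ?d = of_real (\<Sum>u\<in>V. \<Sum>z\<in>nbrs u. (cmod (?d (z, u)))\<^sup>2)"
      by (simp only: norm2_def of_real_sum complex_norm_square)
    ultimately have "(\<Sum>u\<in>V. \<Sum>z\<in>nbrs u. (cmod (?d (z, u)))\<^sup>2) = 0"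
      by (simp only: of_real_eq_0_iff)
    then have "?\<phi> (z, u) = \<gamma> * vstate V E y (z, u)" if "u \<in> V" "z \<in> nbrs u" for u z
      using finite_V that by (simp add: sum_nonneg_eq_0_iff sum_nonneg)
    then show "\<forall>a\<in>arcs V E. ?\<phi> a = \<gamma> * vstate V E y a"
      by (metis arc_iff nbrs_sym nbrsD(1) surj_pair)
  qed
  then show ?thesis unfolding PST_def distinct by blast
qed

text \<open>Pairing with an eigenfunction of the adjacency matrix makes the recurrence scalar:
  f(t+1) = 2 cos \<theta> f(t) - f(t-1), solved by cos (t \<theta>).\<close>

lemma evolve_vstate_eigenfunction:
  fixes \<theta> :: real
  assumes x: "x \<in> V"
    and \<chi>: "\<And>u. u \<in> V \<Longrightarrow> (\<Sum>v\<in>nbrs u. \<chi> v) = of_nat k * of_real (cos \<theta>) * \<chi> u"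
  shows "(\<Sum>u\<in>V. \<chi> u * inflow (evolve V E t (vstate V E x)) u) =
    of_real (cos (t * \<theta>)) * of_real (sqrt k) * \<chi> x"
proof -
  define F where "F \<phi> = (\<Sum>u\<in>V. \<chi> u * inflow \<phi> u)" for \<phi>
  define G where "G \<phi> = (\<Sum>u\<in>V. \<chi> u * outflow \<phi> u)" for \<phi>
  have nb: "(\<Sum>u\<in>V. \<chi> u * (\<Sum>z\<in>nbrs u. f z)) = of_nat k * of_real (cos \<theta>) * (\<Sum>u\<in>V. \<chi> u * f u)" for f
  proof -
    have "(\<Sum>u\<in>V. \<chi> u * (\<Sum>z\<in>nbrs u. f z)) = (\<Sum>z\<in>V. \<Sum>u\<in>nbrs z. \<chi> u * f z)"
      unfolding sum_distrib_left by (rule sum_nbrs_swap)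
    also have "\<dots> = (\<Sum>z\<in>V. of_nat k * of_real (cos \<theta>) * \<chi> z * f z)"
      by (intro sum.cong refl) (simp add: sum_distrib_right[symmetric] \<chi>)
    finally show ?thesis by (simp add: sum_distrib_left mult_ac)
  qed
  have FW: "F (walk \<phi>) = 2 * of_real (cos \<theta>) * F \<phi> - G \<phi>" for \<phi>
  proof -
    have "F (walk \<phi>) = (\<Sum>u\<in>V. 2 / of_nat k * (\<chi> u * (\<Sum>z\<in>nbrs u. inflow \<phi> z)) - \<chi> u * outflow \<phi> u)"
      unfolding F_def by (intro sum.cong refl) (simp add: inflow_walk algebra_simps)
    also have "\<dots> = 2 / of_nat k * (of_nat k * of_real (cos \<theta>) * F \<phi>) - G \<phi>"
      unfolding sum_subtractf sum_distrib_left[symmetric] nb F_def G_def ..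
    finally show ?thesis using k_pos by simp
  qed
  have GW: "G (walk \<phi>) = F \<phi>" for \<phi>
    unfolding F_def G_def by (intro sum.cong refl) (simp add: outflow_walk)
  have F0: "F (vstate V E x) = of_real (sqrt k) * \<chi> x"
  proof -
    have "F (vstate V E x) = (\<Sum>u\<in>V. if u = x then of_real (sqrt k) * \<chi> x else 0)"
      unfolding F_def using x by (intro sum.cong refl) (auto simp: inflow_vstate)
    then show ?thesis using x finite_V by simp
  qed
  \<comment> \<open>The initial outflow plays the role of the inflow at time -1, where cos
    (-\<theta>) = cos \<theta>.\<close>
  have G0: "G (vstate V E x) = of_real (cos \<theta>) * of_real (sqrt k) * \<chi> x"
  proof -
    have "G (vstate V E x) = (\<Sum>u\<in>V. \<chi> u * (\<Sum>z\<in>nbrs u. if z = x then of_real (1 / sqrt k) else 0))"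
      unfolding G_def outflow_def using x
      by (intro sum.cong refl arg_cong2[where f = "(*)"]) (auto simp: vstate_eq)
    also have "\<dots> = of_real (cos \<theta>) * (of_nat k / of_real (sqrt k)) * \<chi> x"
      unfolding nb using x finite_V by (simp add: if_distrib[of "\<lambda>c. _ * c"] cong: if_cong)
    also have "of_nat k / of_real (sqrt k) = (of_real (sqrt k) :: complex)"
      using k_pos by (simp add: divide_eq_eq sqrt_mult)
    finally show ?thesis .
  qed
  \<comment> \<open>The induction carries two consecutive values; the outflow lags by one step,
    hence the angle \<open>t * \<theta> - \<theta>\<close>.\<close>
  have "F (evolve V E t (vstate V E x)) = of_real (cos (t * \<theta>)) * of_real (sqrt k) * \<chi> x \<and>
      G (evolve V E t (vstate V E x)) = of_real (cos (t * \<theta> - \<theta>)) * of_real (sqrt k) * \<chi> x"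
  proof (induction t)
    case 0
    show ?case by (simp add: evolve_0 F0 G0)
  next
    case (Suc t)
    have "cos (Suc t * \<theta>) = 2 * cos \<theta> * cos (t * \<theta>) - cos (t * \<theta> - \<theta>)"
      by (simp add: distrib_right cos_add cos_diff)
    then have "F (evolve V E (Suc t) (vstate V E x)) = of_real (cos (Suc t * \<theta>)) * of_real (sqrt k) * \<chi> x"
      unfolding evolve_Suc FW Suc[THEN conjunct1] Suc[THEN conjunct2]
      by (simp only: of_real_diff of_real_mult of_real_numeral) (simp only: algebra_simps)
    moreover have "Suc t * \<theta> - \<theta> = t * \<theta>" by (simp add: distrib_right)
    ultimately show ?case using Suc by (simp add: evolve_Suc GW)
  qed
  then show ?thesis by (simp add: F_def)
qed

end

subsection \<open>Circulant graphs of valency 4\<close>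

definition character :: "int \<Rightarrow> int \<Rightarrow> int \<Rightarrow> complex" where
  "character n j v = cis (2 * pi * of_int (j * v) / of_int n)"

lemma character_add: "character n j (u + v) = character n j u * character n j v"
  by (simp add: character_def cis_mult algebra_simps add_divide_distrib)

lemma character_diff: "character n j (u - v) = character n j u / character n j v"
  by (simp add: character_def cis_divide algebra_simps diff_divide_distrib)

lemma character_nonzero [simp]: "character n j v \<noteq> 0"
  by (simp add: character_def)

lemma character_eq_1_iff: "n > 0 \<Longrightarrow> character n j v = 1 \<longleftrightarrow> n dvd j * v"
  unfolding character_def by (rule cis_2pi_div_eq_1_iff)

lemma character_mod: "n > 0 \<Longrightarrow> character n j (v mod n) = character n j v"
  using character_add[of n j "v mod n" "n * (v div n)"] character_eq_1_iff[of n j "n * (v div n)"]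
  by simp

text \<open>A geometric sum in the \<open>n\<close>-th root of unity \<open>z\<close>, which
  vanishes unless \<open>z = 1\<close>.\<close>

lemma sum_character:
  assumes "n > 0"
  shows "(\<Sum>j\<in>{0..<n}. character n j v) = (if n dvd v then of_int n else 0)"
proof -
  define z where "z = character n 1 v"
  have "{0..<n} = int ` {..<nat n}" using assms by (simp add: lessThan_atLeast0 image_int_atLeastLessThan)
  then have "(\<Sum>j\<in>{0..<n}. character n j v) = (\<Sum>j<nat n. character n (int j) v)"
    by (simp add: sum.reindex)
  also have "\<dots> = (\<Sum>j<nat n. z ^ j)"
    by (simp add: z_def character_def DeMoivre mult_ac)
  finally have sum: "(\<Sum>j\<in>{0..<n}. character n j v) = (\<Sum>j<nat n. z ^ j)" .
  have zn: "z ^ nat n = character n n v"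
    using assms by (simp add: z_def character_def DeMoivre mult_ac)
  have "z ^ nat n = 1" unfolding zn using assms by (simp add: character_eq_1_iff)
  moreover have "z = 1 \<longleftrightarrow> n dvd v" using assms by (simp add: z_def character_eq_1_iff)
  ultimately show ?thesis
    using assms one_diff_power_eq[of z "nat n"] by (auto simp: sum)
qed

section \<open>The circulant graph, its spectrum and the Fourier form of state transfer\<close>

locale circulant4 =
  fixes l a b :: int
  assumes a: "a \<in> {1..l-1}" and b: "b \<in> {1..l-1}" and a_neq_b: "a \<noteq> b"
begin

abbreviation "n \<equiv> 2 * l"
abbreviation "S \<equiv> {a mod n, (-a) mod n, b mod n, (-b) mod n}"
abbreviation "V \<equiv> circ_V n"
abbreviation "E \<equiv> circ_E n S"

lemma l_pos: "l > 0" and n_pos: "n > 0"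
  using a by auto

text \<open>The residues of \<open>-a\<close> and \<open>-b\<close> are \<open>n - a\<close> and
  \<open>n - b\<close>, which exceed \<open>l\<close>, so a coincidence could only come from
  \<open>a = b\<close>.\<close>

lemma card_S: "card S = 4"
proof -
  have "(-c) mod n = n - c" "c mod n = c" if "c \<in> {1..l-1}" for c
    using that by (simp_all add: zmod_zminus1_eq_if)
  then have "S = {a, n - a, b, n - b}" using a b by simp
  then show ?thesis using a b a_neq_b by (simp add: card_insert_if)
qed

lemma S_residue: "s \<in> S \<Longrightarrow> s mod n = s"
  by auto

lemma S_uminus: "s \<in> S \<Longrightarrow> (- s) mod n \<in> S"
  by (auto simp: mod_minus_eq)

lemma nbrs_eq:
  assumes "u \<in> V"
  shows "{v \<in> V. E u v} = (\<lambda>s. (u + s) mod n) ` S"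
proof (intro equalityI subsetI)
  fix v assume v: "v \<in> {v \<in> V. E u v}"
  then have "v = (u + (v - u) mod n) mod n"
    by (simp add: mod_add_right_eq circ_V_def)
  then show "v \<in> (\<lambda>s. (u + s) mod n) ` S" using v by (auto simp: circ_E_def)
next
  fix v assume "v \<in> (\<lambda>s. (u + s) mod n) ` S"
  then obtain s where s: "s \<in> S" "v = (u + s) mod n" by blast
  then have "(v - u) mod n = s" using S_residue[of s] by (simp add: mod_diff_left_eq)
  then show "v \<in> {v \<in> V. E u v}" using s n_pos by (simp add: circ_E_def circ_V_def)
qed

lemma inj_on_shift: "inj_on (\<lambda>s. (u + s) mod n) S"
proof (rule inj_onI)
  fix s t assume st: "s \<in> S" "t \<in> S" "(u + s) mod n = (u + t) mod n"
  then have "(u + s - u) mod n = (u + t - u) mod n" by (metis mod_diff_left_eq)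
  then show "s = t" using S_residue[OF st(1)] S_residue[OF st(2)] by simp
qed

sublocale regular_graph V E 4
proof
  show "finite V" by (simp add: circ_V_def)
  show "E v u" if "E u v" for u v
    using S_uminus[of "(v - u) mod n"] that unfolding circ_E_def by (simp add: mod_minus_eq)
  show "regular V E 4"
    unfolding regular_def gdeg_def using nbrs_eq card_image[OF inj_on_shift] card_S by simp
qed simp

text \<open>The eigenvalue of A/4 rather than of A: dividing by the valency makes it the cosine of a
  real angle.\<close>

definition adj_eigenvalue :: "int \<Rightarrow> real" where
  "adj_eigenvalue j = (cos (pi * (j * a) / l) + cos (pi * (j * b) / l)) / 2"

lemma sum_nbrs_character:
  assumes "u \<in> V"
  shows "(\<Sum>v\<in>nbrs u. character n j v) = of_nat 4 * of_real (adj_eigenvalue j) * character n j u"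
proof -
  have dist: "a mod n \<notin> {(-a) mod n, b mod n, (-b) mod n}" "(-a) mod n \<notin> {b mod n, (-b) mod n}"
    "b mod n \<noteq> (-b) mod n"
    using card_S by (auto simp: card_insert_if split: if_splits)
  have pm: "character n j c + character n j (-c) = 2 * of_real (cos (pi * (j * c) / l))" for c
    by (simp add: character_def complex_eq_iff)
  have "(\<Sum>v\<in>nbrs u. character n j v) = (\<Sum>s\<in>S. character n j u * character n j s)"
    unfolding nbrs_def nbrs_eq[OF assms] using n_pos
    by (subst sum.reindex[OF inj_on_shift]) (simp add: character_mod character_add del: insert_iff)
  also have "\<dots> = character n j u * (\<Sum>s\<in>S. character n j s)" by (simp add: sum_distrib_left)
  also have "(\<Sum>s\<in>S. character n j s) =
      (character n j a + character n j (-a)) + (character n j b + character n j (-b))"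
    using dist n_pos by (simp add: character_mod)
  also have "\<dots> = of_nat 4 * of_real (adj_eigenvalue j)" unfolding pm by (simp add: adj_eigenvalue_def)
  finally show ?thesis by simp
qed

lemma character_inflow_evolve:
  fixes \<theta> :: real
  assumes "x \<in> V" "cos \<theta> = adj_eigenvalue j"
  shows "(\<Sum>u\<in>V. character n j u * inflow (evolve V E t (vstate V E x)) u) =
    2 * of_real (cos (t * \<theta>)) * character n j x"
  using evolve_vstate_eigenfunction[of x "character n j" \<theta> t] assms
  by (simp add: sum_nbrs_character)

lemma sqrt4: "complex_of_real (sqrt (real 4)) = 2"
  by simp

lemma character_eq_of_PST:
  assumes xy: "x \<in> V" "y \<in> V" and PST: "PST V E (vstate V E x) (vstate V E y) t"
  obtains \<gamma> where "\<And>j (\<theta> :: real). cos \<theta> = adj_eigenvalue j \<Longrightarrow>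
    of_real (cos (t * \<theta>)) * character n j x = \<gamma> * character n j y"
proof -
  obtain \<gamma> where \<gamma>: "\<And>v. v \<in> V \<Longrightarrow> inflow (evolve V E t (vstate V E x)) v = (if v = y then \<gamma> * 2 else 0)"
    using PST unfolding PST_vstate_iff[OF xy] sqrt4 by blast
  have "of_real (cos (t * \<theta>)) * character n j x = \<gamma> * character n j y"
    if "cos \<theta> = adj_eigenvalue j" for j and \<theta> :: real
  proof -
    have "2 * of_real (cos (t * \<theta>)) * character n j x =
        (\<Sum>u\<in>V. if u = y then character n j y * (\<gamma> * 2) else 0)"
      unfolding character_inflow_evolve[OF xy(1) that, symmetric]
      by (intro sum.cong refl) (simp add: \<gamma>)
    then show ?thesis using xy finite_V by simp
  qed
  then show ?thesis using that by blast
qed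

text \<open>Fourier inversion: the pairings of the inflow with all characters are those of
  \<open>2 * \<gamma>\<close> times the indicator of \<open>y\<close>, so the two functions
  agree.\<close>

lemma PST_of_character_eq:
  assumes xy: "x \<in> V" "y \<in> V" "x \<noteq> y" and t: "t \<ge> 1" and \<gamma>: "cmod \<gamma> = 1"
    and eq: "\<And>j. \<exists>\<theta>::real. cos \<theta> = adj_eigenvalue j \<and>
      of_real (cos (t * \<theta>)) * character n j x = \<gamma> * character n j y"
  shows "PST V E (vstate V E x) (vstate V E y) t"
proof -
  let ?\<phi> = "inflow (evolve V E t (vstate V E x))"
  have *: "(\<Sum>w\<in>V. character n j w * ?\<phi> w) = 2 * \<gamma> * character n j y" for j
  proof -
    obtain \<theta> :: real where "cos \<theta> = adj_eigenvalue j"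
      "of_real (cos (t * \<theta>)) * character n j x = \<gamma> * character n j y"
      using eq by blast
    then show ?thesis using character_inflow_evolve[OF xy(1), of \<theta> j t] by simp
  qed
  have orth: "(\<Sum>j\<in>{0..<n}. character n j (w - v)) = (if w = v then of_int n else 0)"
    if "w \<in> V" "v \<in> V" for w v
  proof -
    have "n dvd w - v \<longleftrightarrow> w = v"
      using that mod_eq_dvd_iff[of w n v] by (auto simp: circ_V_def)
    then show ?thesis using sum_character[OF n_pos, of "w - v"] by simp
  qed
  have "?\<phi> v = (if v = y then \<gamma> * 2 else 0)" if v: "v \<in> V" for v
  proof -
    \<comment> \<open>Orthogonality replaces the indicator of \<open>w = v\<close> by a sum over all
      characters.\<close>
    have "of_int n * ?\<phi> v = (\<Sum>w\<in>V. if w = v then ?\<phi> w * of_int n else 0)"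
      using v finite_V by simp
    also have "\<dots> = (\<Sum>w\<in>V. \<Sum>j\<in>{0..<n}. ?\<phi> w * character n j (w - v))"
      using v by (intro sum.cong refl) (auto simp: orth sum_distrib_left[symmetric])
    also have "\<dots> = (\<Sum>j\<in>{0..<n}. \<Sum>w\<in>V. ?\<phi> w * character n j (w - v))"
      by (rule sum.swap)
    also have "\<dots> = (\<Sum>j\<in>{0..<n}. (\<Sum>w\<in>V. character n j w * ?\<phi> w) / character n j v)"
      by (simp add: character_diff sum_divide_distrib mult.commute)
    also have "\<dots> = 2 * \<gamma> * (\<Sum>j\<in>{0..<n}. character n j (y - v))"
      unfolding * by (simp add: character_diff sum_distrib_left)
    finally show ?thesis using orth[OF xy(2) v] l_pos by auto
  qed
  then show ?thesis unfolding PST_vstate_iff[OF xy(1,2)] sqrt4 using xy(3) t \<gamma> by blast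
qed

text \<open>For \<open>b = l - a\<close> the second cosine is (-1)^j times the first, so they cancel
  for odd \<open>j\<close> and agree for even \<open>j\<close>.\<close>

lemma adj_eigenvalue_of_sum_eq:
  assumes "a + b = l"
  shows "adj_eigenvalue j = (if even j then cos (pi * (j * a) / l) else 0)"
proof -
  have b_eq: "b = l - a" using assms by simp
  have "pi * (j * b) / l = pi * of_int j - pi * (j * a) / l"
    using l_pos by (simp add: b_eq field_simps)
  then have "cos (pi * (j * b) / l) = cos (pi * of_int j) * cos (pi * (j * a) / l)"
    by (simp add: cos_diff)
  then show ?thesis by (simp add: adj_eigenvalue_def)
qed

text \<open>The gcd of \<open>a\<close> and \<open>l\<close> divides \<open>b\<close> and
  \<open>n\<close>, hence the difference along every edge; a path from 0 to 1 makes it divide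
  1.\<close>

lemma coprime_of_connected:
  assumes conn: "graph_connected V E" and sum: "a + b = l"
  shows "coprime a l"
proof -
  define d where "d = gcd a l"
  have dl: "d dvd l" and da: "d dvd a" by (auto simp: d_def)
  have db: "d dvd b" using dvd_diff[OF dl da] sum by (metis add_diff_cancel_left')
  have dn: "d dvd n" using dl by simp
  have step: "d dvd v - u" if "E u v" for u v
  proof -
    have "d dvd c mod n" if "d dvd c" for c using that dn by (simp add: dvd_mod)
    then have "\<forall>s\<in>S. d dvd s" using da db by simp
    then have "d dvd (v - u) mod n" using that unfolding circ_E_def by blast
    then show ?thesis using dn by (simp add: dvd_mod_iff)
  qed
  have "(0, 1) \<in> {(u, v). u \<in> V \<and> v \<in> V \<and> E u v}\<^sup>*"
    using conn a by (simp add: graph_connected_def circ_V_def)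
  then have "d dvd 1 - 0"
  proof (induction rule: rtrancl_induct)
    case (step v w)
    then have "d dvd (w - v) + (v - 0)" using \<open>\<And>u v. E u v \<Longrightarrow> d dvd v - u\<close> by (intro dvd_add) auto
    then show ?case by simp
  qed simp
  then show ?thesis by (simp add: d_def coprime_iff_gcd_eq_1)
qed

end

section \<open>Characterization of the transfer times and their minimum\<close>

lemma cos_pi_half_eq_minus_1_iff: "cos (real t * (pi / 2)) = - 1 \<longleftrightarrow> t mod 4 = 2"
proof -
  have "t = t mod 4 + 4 * (t div 4)" by simp
  then have "real t = real (t mod 4 + 4 * (t div 4))" by (rule arg_cong)
  then have "real t = real (t mod 4) + 4 * real (t div 4)"
    by (simp only: of_nat_add of_nat_mult of_nat_numeral)
  then have eq: "real t * (pi / 2) = real (t mod 4) * (pi / 2) + 2 * real (t div 4) * pi"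
    by (simp add: field_simps)
  have "cos (real t * (pi / 2)) = cos (real (t mod 4) * (pi / 2))"
    unfolding eq cos_add cos_2npi sin_2npi by simp
  moreover have "t mod 4 \<in> {0, 1, 2, 3}" by auto
  moreover have "cos (3 * (pi / 2)) = (0 :: real)" using cos_3over2_pi by simp
  ultimately show ?thesis by auto
qed

context circulant4
begin

text \<open>The characters 0, 1 and 2 yield all the conditions: 0 fixes the phase, 1 gives
  \<open>y\<close>, \<open>a + b = l\<close> and \<open>t mod 4 = 2\<close>, and 2 gives
  \<open>l dvd t\<close>. Conversely, these conditions settle every character.\<close>

theorem PST_iff:
  assumes conn: "graph_connected V E" and x: "x \<in> V" and y: "y \<in> V"
  shows "PST V E (vstate V E x) (vstate V E y) t \<longleftrightarrow>
    a + b = l \<and> y = (x + l) mod n \<and> t mod 4 = 2 \<and> l dvd int t"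
proof
  assume PST: "PST V E (vstate V E x) (vstate V E y) t"
  then have "x \<noteq> y" and t: "t \<ge> 1" unfolding PST_vstate_iff[OF x y] by auto
  obtain \<gamma> where \<gamma>: "\<And>j (\<theta> :: real). cos \<theta> = adj_eigenvalue j \<Longrightarrow>
      of_real (cos (t * \<theta>)) * character n j x = \<gamma> * character n j y"
    using character_eq_of_PST[OF x y PST] by blast
  have "\<gamma> = 1" using \<gamma>[of 0 0] by (simp add: adj_eigenvalue_def character_def)
  then have char: "character n j (y - x) = of_real (cos (t * \<theta>))" if "cos \<theta> = adj_eigenvalue j" for j and \<theta> :: real
    using \<gamma>[OF that] by (simp add: character_diff divide_eq_eq)
  define \<theta> where "\<theta> = arccos (adj_eigenvalue 1)"
  have "\<bar>(c + d) / 2\<bar> \<le> 1" if "\<bar>c\<bar> \<le> 1" "\<bar>d\<bar> \<le> 1" for c d :: real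
    using that unfolding abs_le_iff by auto
  then have "\<bar>adj_eigenvalue 1\<bar> \<le> 1"
    unfolding adj_eigenvalue_def using abs_cos_le_one by blast
  then have \<theta>: "cos \<theta> = adj_eigenvalue 1" by (simp add: \<theta>_def cos_arccos_abs)
  \<comment> \<open>The character value is a real cosine, so \<open>y - x\<close> is a multiple of
    \<open>l\<close>; it is nonzero and smaller than \<open>2 * l\<close> in absolute value.\<close>
  have "Im (character n 1 (y - x)) = 0" unfolding char[OF \<theta>] by simp
  then have "sin (pi * (y - x) / l) = 0" by (simp add: character_def)
  then obtain m :: int where "pi * (y - x) / l = m * pi" using sin_zero_iff_int2 by blast
  then have "pi * of_int (y - x) = pi * of_int (m * l)" using l_pos by (simp add: field_simps)
  then have "real_of_int (y - x) = of_int (m * l)" by (simp only: mult_left_cancel[OF pi_neq_zero])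
  then have m: "y - x = m * l" by (simp only: of_int_eq_iff)
  have "m * l < 2 * l" "(-2) * l < m * l"
    unfolding m[symmetric] using x y by (auto simp: circ_V_def)
  then have "m < 2" "-2 < m" using l_pos by (simp_all only: mult_less_cancel_right_pos)
  moreover have "m \<noteq> 0" using m \<open>x \<noteq> y\<close> by auto
  ultimately have m1: "m = 1 \<or> m = -1" by linarith
  then have yx: "y - x = l \<or> y - x = - l" using m by auto
  have y_eq: "y = (x + l) mod n"
  proof -
    have "n dvd y - (x + l)" using yx by (auto simp: algebra_simps)
    then show ?thesis using y mod_eq_dvd_iff[of y n "x + l"] by (simp add: circ_V_def)
  qed
  have char_yx: "character n j (y - x) = (if even j then 1 else -1)" for j
  proof -
    have "2 * pi * of_int (j * (y - x)) / of_int n = pi * of_int (j * m)"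
      using l_pos by (simp add: m)
    then show ?thesis using m1
      by (auto simp: character_def complex_eq_iff simp del: of_int_mult)
  qed
  have "cos (t * \<theta>) = -1"
    using char[OF \<theta>] char_yx[of 1] by (simp add: complex_eq_iff)
  then have "sin (t * \<theta>) = 0" using sin_cos_squared_add[of "t * \<theta>"] by simp
  then have sum: "a + b = l"
    using sum_eq_of_cos_pi_rational[OF a b a_neq_b, of t \<theta>] t \<theta> by (simp add: adj_eigenvalue_def)
  \<comment> \<open>Once \<open>a + b = l\<close> is known, the eigenvalue at 1 is 0 and the
    explicit angle \<open>pi / 2\<close> can replace the arccosine.\<close>
  have "cos (pi / 2) = adj_eigenvalue 1" using adj_eigenvalue_of_sum_eq[OF sum, of 1] by simp
  then have t4: "t mod 4 = 2"
    using char[of "pi / 2" 1] char_yx[of 1] cos_pi_half_eq_minus_1_iff[of t]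
    by (simp add: complex_eq_iff)
  have "cos (pi * (2 * a) / l) = adj_eigenvalue 2" using adj_eigenvalue_of_sum_eq[OF sum, of 2] by simp
  then have "cos (t * (pi * (2 * a) / l)) = 1"
    using char[of "pi * (2 * a) / l" 2] char_yx[of 2] by (simp add: complex_eq_iff)
  then have "cis (2 * pi * of_int (t * a) / of_int l) = 1"
    using sin_cos_squared_add[of "t * (pi * (2 * a) / l)"] by (simp add: complex_eq_iff mult_ac)
  then have "l dvd int t * a" using cis_2pi_div_eq_1_iff[OF l_pos] by blast
  then have "l dvd int t"
    using coprime_of_connected[OF conn sum] by (simp add: coprime_dvd_mult_left_iff coprime_commute)
  then show "a + b = l \<and> y = (x + l) mod n \<and> t mod 4 = 2 \<and> l dvd int t"
    using sum y_eq t4 by blast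
next
  assume H: "a + b = l \<and> y = (x + l) mod n \<and> t mod 4 = 2 \<and> l dvd int t"
  then have sum: "a + b = l" and y_eq: "y = (x + l) mod n" and t4: "t mod 4 = 2" by auto
  obtain q where q: "int t = l * q" using H by blast
  have "x \<noteq> y"
  proof
    assume "x = y"
    moreover have "x mod n = x" using x by (simp add: circ_V_def)
    ultimately have "x mod n = (x + l) mod n" using y_eq by metis
    then have "n dvd l" using mod_eq_dvd_iff[of "x + l" n x] by simp
    then show False using l_pos zdvd_not_zless by fastforce
  qed
  moreover have "t \<ge> 1" using t4 by (cases t) auto
  \<comment> \<open>The angle is \<open>pi * (j * a) / l\<close> for even \<open>j\<close> and
    \<open>pi / 2\<close> for odd \<open>j\<close>; the phase is 1.\<close>
  moreover have "\<exists>\<theta>::real. cos \<theta> = adj_eigenvalue j \<and>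
      of_real (cos (t * \<theta>)) * character n j x = 1 * character n j y" for j
  proof -
    have char_l: "character n j l = (if even j then 1 else -1)"
      using l_pos cos_npi_int[of j] sin_npi_int[of j] by (auto simp: character_def complex_eq_iff mult.commute)
    have char_y: "character n j y = character n j x * character n j l"
      using n_pos by (simp add: y_eq character_mod character_add)
    show ?thesis
    proof (cases "even j")
      case True
      then obtain i where j: "j = 2 * i" by blast
      have "t * (pi * (j * a) / l) = 2 * pi * of_int (q * i * a)"
      proof -
        have "real t = l * q" using q by (metis of_int_mult of_int_of_nat_eq)
        then show ?thesis using l_pos by (simp add: j field_simps)
      qed
      then have "cos (t * (pi * (j * a) / l)) = 1" by (simp only: cos_int_2pin)
      then show ?thesis using True adj_eigenvalue_of_sum_eq[OF sum, of j]
        by (intro exI[of _ "pi * (j * a) / l"]) (simp add: char_y char_l)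
    next
      case False
      then show ?thesis using adj_eigenvalue_of_sum_eq[OF sum, of j] t4 cos_pi_half_eq_minus_1_iff[of t]
        by (intro exI[of _ "pi / 2"]) (simp add: char_y char_l)
    qed
  qed
  ultimately show "PST V E (vstate V E x) (vstate V E y) t"
    by (intro PST_of_character_eq[where \<gamma> = 1] x y) auto
qed

end

text \<open>For odd \<open>l\<close> an admissible time is an even multiple of \<open>l\<close>, and
  \<open>2 * l\<close> is itself 2 modulo 4. For \<open>l mod 4 = 2\<close> already \<open>l\<close>
  is admissible, and for \<open>4 dvd l\<close> nothing is.\<close>

lemma minimal_multiple_2_mod_4:
  fixes l :: int and t :: nat
  assumes "l > 0"
  shows "t mod 4 = 2 \<and> l dvd int t \<and> (\<forall>s. 1 \<le> s \<and> s < t \<longrightarrow> \<not> (s mod 4 = 2 \<and> l dvd int s)) \<longleftrightarrow>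
    (odd l \<and> int t = 2 * l) \<or> (l mod 4 = 2 \<and> int t = l)"
    (is "?P t \<and> ?D t \<and> ?M \<longleftrightarrow> _")
proof -
  have even: "2 * l dvd int s" if "odd l" "s mod 4 = 2" "l dvd int s" for s
  proof -
    have "2 dvd int s" using that(2) by presburger
    then show ?thesis using that by (simp add: divides_mult)
  qed
  have four: "\<not> 4 dvd l" if "s mod 4 = 2" "l dvd int s" for s
  proof
    assume "4 dvd l"
    then have "4 dvd int s" using that(2) dvd_trans by blast
    then show False using that(1) by presburger
  qed
  show ?thesis
  proof
    assume L: "?P t \<and> ?D t \<and> ?M"
    then have t: "t > 0" by (cases t) auto
    show "(odd l \<and> int t = 2 * l) \<or> (l mod 4 = 2 \<and> int t = l)"
    proof (cases "odd l")
      case True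
      then have "2 * l dvd int t" using even L by blast
      then have le: "2 * l \<le> int t" using t by (simp add: zdvd_imp_le)
      have "(2 * l) mod 4 = 2" using True by presburger
      then have "int (nat (2 * l) mod 4) = int 2" using assms by (simp add: zmod_int)
      then have "nat (2 * l) mod 4 = 2" by (simp only: of_nat_eq_iff)
      moreover have "l dvd int (nat (2 * l))" using assms by simp
      moreover have "1 \<le> nat (2 * l)" using assms by simp
      ultimately have "\<not> nat (2 * l) < t" using L by blast
      then have "int t \<le> int (nat (2 * l))" by (simp only: of_nat_le_iff not_less)
      also have "\<dots> = 2 * l" using assms by simp
      finally have "int t \<le> 2 * l" .
      then have "int t = 2 * l" using le by linarith
      with True show ?thesis by (intro disjI1 conjI)
    next
      case False
      moreover have "\<not> 4 dvd l" using four L by blast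
      ultimately have l4: "l mod 4 = 2" by presburger
      have le: "l \<le> int t" using L t by (simp add: zdvd_imp_le)
      have "int (nat l mod 4) = int 2" using l4 assms by (simp add: zmod_int)
      then have "nat l mod 4 = 2" by (simp only: of_nat_eq_iff)
      moreover have "l dvd int (nat l)" using assms by simp
      moreover have "1 \<le> nat l" using assms by simp
      ultimately have "\<not> nat l < t" using L by blast
      then have "int t \<le> int (nat l)" by (simp only: of_nat_le_iff not_less)
      also have "\<dots> = l" using assms by simp
      finally have "int t \<le> l" .
      then have "int t = l" using le by linarith
      with l4 show ?thesis by (intro disjI2 conjI)
    qed
  next
    assume R: "(odd l \<and> int t = 2 * l) \<or> (l mod 4 = 2 \<and> int t = l)"
    then have "int t mod 4 = 2" by presburger
    then have "int (t mod 4) = int 2" by (simp add: zmod_int)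
    then have "?P t" by (simp only: of_nat_eq_iff)
    moreover have "?D t" using R by (elim disjE conjE) simp_all
    moreover have ?M
    proof (intro allI impI notI)
      fix s assume s: "1 \<le> s \<and> s < t" "s mod 4 = 2 \<and> l dvd int s"
      then have s_pos: "0 < int s" by simp
      from R show False
      proof
        assume t: "odd l \<and> int t = 2 * l"
        then have "2 * l dvd int s" using even s by blast
        then have "int t \<le> int s" unfolding t[THEN conjunct2] using s_pos by (rule zdvd_imp_le)
        then show False using s by linarith
      next
        assume t: "l mod 4 = 2 \<and> int t = l"
        then have "int t dvd int s" using s by metis
        then have "int t \<le> int s" using s_pos by (rule zdvd_imp_le)
        then show False using s by linarith
      qed
    qed
    ultimately show "?P t \<and> ?D t \<and> ?M" by blast
  qed
qed

theorem theorem1p3: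
  fixes l a b x y :: int and \<tau> :: nat
  assumes "l \<ge> 2"
    and "a \<in> {1..l-1}" and "b \<in> {1..l-1}"
    and "graph_connected (circ_V (2*l)) (circ_E (2*l) {a mod (2*l), (-a) mod (2*l), b mod (2*l), (-b) mod (2*l)})"
    and "regular (circ_V (2*l)) (circ_E (2*l) {a mod (2*l), (-a) mod (2*l), b mod (2*l), (-b) mod (2*l)}) 4"
    and "x \<in> circ_V (2*l)" and "y \<in> circ_V (2*l)"
  shows "min_PST_time (circ_V (2*l)) (circ_E (2*l) {a mod (2*l), (-a) mod (2*l), b mod (2*l), (-b) mod (2*l)})
           (vstate (circ_V (2*l)) (circ_E (2*l) {a mod (2*l), (-a) mod (2*l), b mod (2*l), (-b) mod (2*l)}) x)
           (vstate (circ_V (2*l)) (circ_E (2*l) {a mod (2*l), (-a) mod (2*l), b mod (2*l), (-b) mod (2*l)}) y) \<tau>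
    \<longleftrightarrow> a + b = l \<and> y = (x + l) mod (2*l) \<and>
        ((odd l \<and> int \<tau> = 2*l) \<or> (l mod 4 = 2 \<and> int \<tau> = l))"
proof -
  \<comment> \<open>Otherwise vertex 0 would have at most two neighbours, against
    4-regularity.\<close>
  have "a \<noteq> b"
  proof
    assume ab: "a = b"
    let ?N = "{y \<in> circ_V (2*l). circ_E (2*l) {a mod (2*l), (-a) mod (2*l), b mod (2*l), (-b) mod (2*l)} 0 y}"
    have "?N \<subseteq> {a mod (2*l), (-a) mod (2*l)}"
      by (auto simp: ab circ_V_def circ_E_def)
    then have "card ?N \<le> card {a mod (2*l), (-a) mod (2*l)}" by (intro card_mono) auto
    also have "\<dots> \<le> 2" by (simp add: card_insert_if)
    finally show False
      using assms(1,5) by (simp add: regular_def gdeg_def circ_V_def)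
  qed
  then interpret circulant4 l a b using assms by unfold_locales auto
  show ?thesis
    unfolding min_PST_time_def PST_iff[OF assms(4,6,7)] 
    using minimal_multiple_2_mod_4[OF l_pos, of \<tau>] by blast
qed

end
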